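(* Let $\gamma\ge 1$ and let $\{b_n\}_{n\in\mathbb Z}$ be a real sequence with $b_n\ge 0$ for all $n$ and $\{b_n\}\in \ell^{\gamma+1/2}(\mathbb Z)$. Let $\{e_j\}$ be the negative eigenvalues of the operator on $\ell^2(\mathbb Z)$ $$H_D\varphi(n)=-\varphi(n+1)-\varphi(n-1)+2\varphi(n)-b_n\varphi(n),\qquad n\in\mathbb Z.$$ Then $$\sum_j |e_j|^\gamma\le \frac{\pi}{\sqrt3}\,L^{cl}_{\gamma,1}\sum_{n\in\mathbb Z} b_n^{\gamma+1/2},\qquad L^{cl}_{\gamma,1}=\frac{\Gamma(\gamma+1)}{2\sqrt\pi\,\Gamma(\gamma+3/2)}.$$
   Context: The operator is $D^*D-b_n$ where $D\varphi(n)=\varphi(n+1)-\varphi(n)$ on $\ell^2(\mathbb Z)$ and $D^*\varphi(n)=-(\varphi(n)-\varphi(n-1))$; $b_n$ acts as multiplication. *)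

theory Defs
  imports "HOL-Analysis.Analysis"
begin

definition l2_seq :: "(int \<Rightarrow> real) \<Rightarrow> bool" where
  "l2_seq \<phi> \<longleftrightarrow> (\<lambda>n. (\<phi> n)\<^sup>2) summable_on UNIV"

definition Dfw :: "(int \<Rightarrow> real) \<Rightarrow> int \<Rightarrow> real" where
  "Dfw \<phi> n = \<phi> (n + 1) - \<phi> n"

definition Dadj :: "(int \<Rightarrow> real) \<Rightarrow> int \<Rightarrow> real" where
  "Dadj \<phi> n = - (\<phi> n - \<phi> (n - 1))"

definition H_D :: "(int \<Rightarrow> real) \<Rightarrow> (int \<Rightarrow> real) \<Rightarrow> int \<Rightarrow> real" where
  "H_D b \<phi> n = Dadj (Dfw \<phi>) n - b n * \<phi> n"

definition eigvec :: "(int \<Rightarrow> real) \<Rightarrow> real \<Rightarrow> (int \<Rightarrow> real) \<Rightarrow> bool" where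
  "eigvec b e \<phi> \<longleftrightarrow> l2_seq \<phi> \<and> H_D b \<phi> = (\<lambda>n. e * \<phi> n)"

definition is_eigenvalue :: "(int \<Rightarrow> real) \<Rightarrow> real \<Rightarrow> bool" where
  "is_eigenvalue b e \<longleftrightarrow> (\<exists>\<phi>. eigvec b e \<phi> \<and> \<phi> \<noteq> (\<lambda>_. 0))"

definition lin_indep_fun :: "(int \<Rightarrow> real) set \<Rightarrow> bool" where
  "lin_indep_fun S \<longleftrightarrow>
     (\<forall>c. (\<forall>n. (\<Sum>\<phi>\<in>S. c \<phi> * \<phi> n) = 0) \<longrightarrow> (\<forall>\<phi>\<in>S. c \<phi> = 0))"

definition eig_mult :: "(int \<Rightarrow> real) \<Rightarrow> real \<Rightarrow> ennreal" where
  "eig_mult b e = (SUP S \<in> {S. finite S \<and> (\<forall>\<phi>\<in>S. eigvec b e \<phi>) \<and> lin_indep_fun S}.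
                     of_nat (card S))"

definition L_cl :: "real \<Rightarrow> real" where
  "L_cl \<gamma> = Gamma (\<gamma> + 1) / (2 * sqrt pi * Gamma (\<gamma> + 3/2))"

end

theory Submission
  imports Defs
begin

text \<open>
  Telescoping \<open>f\<^sup>2\<close> from both sides and applying Cauchy--Schwarz gives \<open>(f n)\<^sup>2 \<le> \<parallel>f\<parallel> \<parallel>D f\<parallel>\<close>.
  For an orthonormal system \<open>\<phi>\<^sub>j\<close> with density \<open>\<rho> n = \<Sum>j. (\<phi>\<^sub>j n)\<^sup>2\<close>, take \<open>f = \<Sum>j. \<phi>\<^sub>j n \<cdot> \<phi>\<^sub>j\<close>
  (Eden--Foias): then \<open>f n = \<parallel>f\<parallel>\<^sup>2 = \<rho> n\<close>, so \<open>(\<rho> n)\<^sup>3 \<le> \<parallel>D f\<parallel>\<^sup>2\<close>, and summing over \<open>n\<close> yields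
  \<open>\<Sum>n. (\<rho> n)\<^sup>3 \<le> \<Sum>j. \<parallel>D \<phi>\<^sub>j\<parallel>\<^sup>2\<close>. If the \<open>\<phi>\<^sub>j\<close> are eigenvectors, the sum of \<open>- e\<^sub>j - t\<close> is therefore at
  most the sum of \<open>(b n - t) \<rho> n - (\<rho> n)\<^sup>3\<close>, which Young's inequality bounds by \<open>2 / (3 \<surd>3)\<close> times
  the sum of \<open>(b n - t)\<^sub>+\<close> to the power \<open>3/2\<close>. The case \<open>\<gamma> = 1\<close> is \<open>t = 0\<close>; for \<open>\<gamma> > 1\<close> one integrates
  against \<open>t\<close> to the power \<open>\<gamma> - 2\<close> (Aizenman--Lieb), both sides being Beta integrals. Eigenvalues are
  simple, since the Wronskian of two square-summable solutions is constant and tends to 0.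
\<close>

section \<open>Infinite sums\<close>

lemma has_sum_sum:
  fixes f :: "'i \<Rightarrow> 'a \<Rightarrow> 'b::topological_comm_monoid_add"
  assumes "\<And>i. i \<in> I \<Longrightarrow> (f i has_sum s i) A"
  shows "((\<lambda>n. \<Sum>i\<in>I. f i n) has_sum (\<Sum>i\<in>I. s i)) A"
  using assms
  by (induction I rule: infinite_finite_induct) (simp_all add: has_sum_0 has_sum_add)

lemma summable_on_mult_of_summable_on_squares:
  fixes f g :: "'a \<Rightarrow> real"
  assumes "(\<lambda>x. (f x)\<^sup>2) summable_on A" "(\<lambda>x. (g x)\<^sup>2) summable_on A"
  shows "(\<lambda>x. f x * g x) summable_on A"
  using assms
  by (intro abs_summable_summable[OF abs_summable_product]) (simp_all add: power2_eq_square)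

lemma summable_on_square_add:
  fixes f g :: "'a \<Rightarrow> real"
  assumes "(\<lambda>x. (f x)\<^sup>2) summable_on A" "(\<lambda>x. (g x)\<^sup>2) summable_on A"
  shows "(\<lambda>x. (f x + g x)\<^sup>2) summable_on A"
  unfolding power2_sum mult.assoc
  by (intro summable_on_add summable_on_cmult_right summable_on_mult_of_summable_on_squares assms)

lemma nn_integral_count_space_eq_infsum:
  fixes f :: "'a \<Rightarrow> real"
  assumes "\<And>x. x \<in> A \<Longrightarrow> f x \<ge> 0"
  shows "(\<integral>\<^sup>+x. ennreal (f x) \<partial>count_space A)
    = (if f summable_on A then ennreal (infsum f A) else \<infinity>)"
proof -
  have summable_iff: "f summable_on A \<longleftrightarrow> Infinite_Set_Sum.abs_summable_on f A"
    using summable_on_iff_abs_summable_on_real[of f A] abs_summable_equivalent[of f A] by simp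
  show ?thesis
  proof (cases "f summable_on A")
    case True
    then show ?thesis
      using nn_integral_conv_infsetsum[of f A] assms by (simp add: summable_iff infsetsum_infsum)
  next
    case False
    then have "\<not> (\<integral>\<^sup>+x. ennreal (f x) \<partial>count_space A) < \<infinity>"
      using integrableI_nonneg[of f "count_space A"] assms
      by (auto simp: summable_iff Infinite_Set_Sum.abs_summable_on_def AE_count_space)
    then show ?thesis
      using False by (simp add: not_less top_unique)
  qed
qed

section \<open>The inner product space of square-summable functions\<close>

typedef 'a ell2 = "{f :: 'a \<Rightarrow> real. (\<lambda>x. (f x)\<^sup>2) summable_on UNIV}"
  morphisms apply_ell2 Ell2
  by (intro exI[of _ "\<lambda>_. 0"]) simp

declare [[coercion "apply_ell2 :: 'a ell2 \<Rightarrow> 'a \<Rightarrow> real"]]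

setup_lifting type_definition_ell2

instantiation ell2 :: (type) real_vector
begin

lift_definition zero_ell2 :: "'a ell2" is "\<lambda>_. 0"
  by simp

lift_definition plus_ell2 :: "'a ell2 \<Rightarrow> 'a ell2 \<Rightarrow> 'a ell2" is "\<lambda>f g x. f x + g x"
  by (rule summable_on_square_add)

lift_definition uminus_ell2 :: "'a ell2 \<Rightarrow> 'a ell2" is "\<lambda>f x. - f x"
  by simp

lift_definition minus_ell2 :: "'a ell2 \<Rightarrow> 'a ell2 \<Rightarrow> 'a ell2" is "\<lambda>f g x. f x - g x"
  using summable_on_square_add[where g = "\<lambda>x. - g x" for g] by simp

lift_definition scaleR_ell2 :: "real \<Rightarrow> 'a ell2 \<Rightarrow> 'a ell2" is "\<lambda>c f x. c * f x"
  by (simp add: power_mult_distrib summable_on_cmult_right)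

instance
  by standard (transfer, simp add: fun_eq_iff algebra_simps)+

end

instantiation ell2 :: (type) real_inner
begin

lift_definition inner_ell2 :: "'a ell2 \<Rightarrow> 'a ell2 \<Rightarrow> real" is "\<lambda>f g. \<Sum>\<^sub>\<infinity>x. f x * g x" .

definition norm_ell2 :: "'a ell2 \<Rightarrow> real"
  where "norm_ell2 f = sqrt (f \<bullet> f)"

definition sgn_ell2 :: "'a ell2 \<Rightarrow> 'a ell2"
  where "sgn_ell2 f = f /\<^sub>R norm f"

definition dist_ell2 :: "'a ell2 \<Rightarrow> 'a ell2 \<Rightarrow> real"
  where "dist_ell2 f g = norm (f - g)"

definition uniformity_ell2 :: "('a ell2 \<times> 'a ell2) filter"
  where "uniformity_ell2 = (INF e\<in>{0 <..}. principal {(f, g). dist f g < e})"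

definition open_ell2 :: "'a ell2 set \<Rightarrow> bool"
  where "open_ell2 S = (\<forall>f\<in>S. \<forall>\<^sub>F (f', g) in uniformity. f' = f \<longrightarrow> g \<in> S)"

instance
proof
  fix f g h :: "'a ell2" and c :: real
  show "f \<bullet> g = g \<bullet> f"
    by transfer (simp add: mult.commute)
  show "(f + g) \<bullet> h = f \<bullet> h + g \<bullet> h"
    by transfer (simp add: distrib_right infsum_add summable_on_mult_of_summable_on_squares)
  show "(c *\<^sub>R f) \<bullet> g = c * (f \<bullet> g)"
    by transfer (simp add: mult.assoc infsum_cmult_right')
  show "0 \<le> f \<bullet> f"
    by transfer (simp add: infsum_nonneg)
  show "f \<bullet> f = 0 \<longleftrightarrow> f = 0"
  proof
    assume "f \<bullet> f = 0"
    then have "f x * f x = 0" for x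
      by transfer (rule nonneg_infsum_le_0D, auto simp: power2_eq_square)
    then show "f = 0"
      by transfer auto
  qed (transfer, simp)
qed (rule norm_ell2_def sgn_ell2_def dist_ell2_def uniformity_ell2_def open_ell2_def)+

end

lemma has_sum_inner_ell2:
  fixes f g :: "'a ell2"
  shows "((\<lambda>x. f x * g x) has_sum (f \<bullet> g)) UNIV"
  by transfer (rule has_sum_infsum[OF summable_on_mult_of_summable_on_squares])

lemma apply_ell2_simps [simp]:
  fixes f g :: "'a ell2"
  shows "(0 :: 'a ell2) x = 0" "(f + g) x = f x + g x"
    "(f - g) x = f x - g x" "(c *\<^sub>R f) x = c * f x"
  by (transfer, simp)+

lemma apply_sum_ell2 [simp]:
  fixes f :: "'i \<Rightarrow> 'a ell2"
  shows "(\<Sum>i\<in>I. f i) x = (\<Sum>i\<in>I. f i x)"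
  by (induction I rule: infinite_finite_induct) simp_all

lemma L2_set_le_norm_ell2:
  fixes f :: "'a ell2"
  assumes "finite A"
  shows "L2_set f A \<le> norm f"
  unfolding L2_set_def norm_ell2_def
  using finite_sum_le_has_sum[OF has_sum_inner_ell2 assms] by (simp add: power2_eq_square)

lemma sum_abs_mult_le_norm_ell2:
  fixes f g :: "'a ell2"
  assumes "finite A"
  shows "(\<Sum>x\<in>A. \<bar>f x\<bar> * \<bar>g x\<bar>) \<le> norm f * norm g"
  using assms
  by (intro order_trans[OF L2_set_mult_ineq] mult_mono L2_set_le_norm_ell2 norm_ge_zero
      L2_set_nonneg)

lemma ell2_tendsto_0:
  fixes f :: "'a ell2" and h :: "nat \<Rightarrow> 'a"
  assumes "inj h"
  shows "(\<lambda>k. f (h k)) \<longlonglongrightarrow> 0"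
proof -
  have "(\<lambda>x. (f x)\<^sup>2) summable_on range h"
    using apply_ell2[of f] by (auto intro: summable_on_subset_banach)
  then have "(\<lambda>k. (f (h k))\<^sup>2) summable_on UNIV"
    using summable_on_reindex[OF assms, of "\<lambda>x. (f x)\<^sup>2"] by (simp add: o_def)
  then have "(\<lambda>k. (f (h k))\<^sup>2) \<longlonglongrightarrow> 0"
    by (intro summable_LIMSEQ_zero summable_on_imp_summable)
  then show ?thesis
    by (simp add: tendsto_power_zero)
qed

section \<open>Finite differences\<close>

lift_definition shift :: "'a::group_add \<Rightarrow> 'a ell2 \<Rightarrow> 'a ell2" is "\<lambda>k f x. f (x + k)"
  using bij_plus_right by (subst summable_on_reindex_bij_betw)

lemma inner_shift_left: "shift k f \<bullet> g = f \<bullet> shift (- k) g"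
  using infsum_reindex_bij_betw[OF bij_plus_right, of "\<lambda>x. f x * shift (- k) g x" k]
  by (simp add: inner_ell2.rep_eq shift.rep_eq)

lemma norm_shift [simp]: "norm (shift k f) = norm f"
proof -
  have "shift (- k) (shift k f) = f"
    by transfer simp
  then show ?thesis
    by (simp add: norm_ell2_def inner_shift_left)
qed

lemma linear_shift: "linear (shift k)"
  by (rule linearI; transfer) auto

definition fwd_diff :: "int ell2 \<Rightarrow> int ell2"
  where "fwd_diff f = shift 1 f - f"

definition adj_diff :: "int ell2 \<Rightarrow> int ell2"
  where "adj_diff f = shift (- 1) f - f"

lemma apply_fwd_diff: "apply_ell2 (fwd_diff f) = Dfw f"
  by (auto simp: fwd_diff_def Dfw_def shift.rep_eq)

lemma apply_adj_diff: "apply_ell2 (adj_diff f) = Dadj f"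
  by (auto simp: adj_diff_def Dadj_def shift.rep_eq)

lemma inner_fwd_diff_left: "fwd_diff f \<bullet> g = f \<bullet> adj_diff g"
  by (simp add: fwd_diff_def adj_diff_def inner_shift_left algebra_simps)

lemma linear_fwd_diff: "linear fwd_diff"
  unfolding fwd_diff_def[abs_def] by (intro linear_compose_sub linear_shift linear_ident)

lemma linear_adj_diff: "linear adj_diff"
  unfolding adj_diff_def[abs_def] by (intro linear_compose_sub linear_shift linear_ident)

lemma norm_diff_le_sum_norm_steps:
  fixes g :: "int \<Rightarrow> 'a::real_normed_vector"
  assumes "a \<le> b"
  shows "norm (g b - g a) \<le> (\<Sum>m\<in>{a..<b}. norm (g (m + 1) - g m))"
  using assms
proof (induction b rule: int_ge_induct)
  case (step b)
  then have "{a..<b + 1} = insert b {a..<b}"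
    by auto
  moreover have "norm (g (b + 1) - g a) \<le> norm (g (b + 1) - g b) + norm (g b - g a)"
    using norm_triangle_ineq[of "g (b + 1) - g b" "g b - g a"] by simp
  ultimately show ?case
    using step by simp
qed simp

lemma two_sided_norm_diff_le_sum_norm_steps:
  fixes g :: "int \<Rightarrow> 'a::real_normed_vector"
  assumes "a \<le> n" "n \<le> b"
  shows "norm (g b - g n) + norm (g n - g a) \<le> (\<Sum>m\<in>{a..<b}. norm (g (m + 1) - g m))"
proof -
  have "{a..<b} = {a..<n} \<union> {n..<b}"
    using assms by auto
  then have "(\<Sum>m\<in>{a..<b}. norm (g (m + 1) - g m))
      = (\<Sum>m\<in>{a..<n}. norm (g (m + 1) - g m)) + (\<Sum>m\<in>{n..<b}. norm (g (m + 1) - g m))"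
    by (simp add: sum.union_disjoint)
  then show ?thesis
    using norm_diff_le_sum_norm_steps[OF assms(1), of g]
      norm_diff_le_sum_norm_steps[OF assms(2), of g]
    by linarith
qed

lemma ell2_square_le_norm_mult_norm_fwd_diff:
  fixes f :: "int ell2"
  shows "(f n)\<^sup>2 \<le> norm f * norm (fwd_diff f)"
proof -
  define d s where "d = fwd_diff f" and "s = shift 1 f + f"
  have step: "norm ((f (m + 1))\<^sup>2 - (f m)\<^sup>2) = \<bar>d m\<bar> * \<bar>s m\<bar>" for m
    unfolding d_def s_def
    by (simp add: fwd_diff_def shift.rep_eq power2_eq_square algebra_simps flip: abs_mult)
  have partial_sums: "\<bar>(f (n + int k))\<^sup>2 - (f n)\<^sup>2\<bar> + \<bar>(f n)\<^sup>2 - (f (n - int k))\<^sup>2\<bar>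
      \<le> norm d * norm s" for k
  proof -
    have "\<bar>(f (n + int k))\<^sup>2 - (f n)\<^sup>2\<bar> + \<bar>(f n)\<^sup>2 - (f (n - int k))\<^sup>2\<bar>
        \<le> (\<Sum>m\<in>{n - int k..<n + int k}. \<bar>d m\<bar> * \<bar>s m\<bar>)"
      using two_sided_norm_diff_le_sum_norm_steps[of "n - int k" n "n + int k" "\<lambda>m. (f m)\<^sup>2"]
      unfolding step by simp
    also have "\<dots> \<le> norm d * norm s"
      by (rule sum_abs_mult_le_norm_ell2) simp
    finally show ?thesis .
  qed
  have "(\<lambda>k. \<bar>(f (n + int k))\<^sup>2 - (f n)\<^sup>2\<bar> + \<bar>(f n)\<^sup>2 - (f (n - int k))\<^sup>2\<bar>)
      \<longlonglongrightarrow> \<bar>0\<^sup>2 - (f n)\<^sup>2\<bar> + \<bar>(f n)\<^sup>2 - 0\<^sup>2\<bar>"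
    by (intro tendsto_intros ell2_tendsto_0) (simp_all add: inj_def)
  then have "2 * (f n)\<^sup>2 \<le> norm d * norm s"
    using LIMSEQ_le_const2 partial_sums by fastforce
  also have "\<dots> \<le> norm d * (2 * norm f)"
    unfolding s_def using norm_triangle_ineq[of "shift 1 f" f] by (intro mult_left_mono) auto
  finally show ?thesis
    unfolding d_def by (simp add: mult_ac)
qed

section \<open>The kinetic energy of orthonormal families\<close>

definition orthonormal_family :: "'i set \<Rightarrow> ('i \<Rightarrow> 'v::real_inner) \<Rightarrow> bool"
  where "orthonormal_family J \<phi> \<longleftrightarrow> (\<forall>i\<in>J. \<forall>j\<in>J. \<phi> i \<bullet> \<phi> j = of_bool (i = j))"

lemma norm_orthonormal_family:
  assumes "orthonormal_family J \<phi>" "j \<in> J"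
  shows "norm (\<phi> j) = 1"
  using assms by (simp add: orthonormal_family_def norm_eq_1)

lemma norm_sum_orthonormal_family:
  assumes "finite J" "orthonormal_family J \<phi>"
  shows "(norm (\<Sum>j\<in>J. c j *\<^sub>R \<phi> j))\<^sup>2 = (\<Sum>j\<in>J. (c j)\<^sup>2)"
proof -
  have "(norm (\<Sum>j\<in>J. c j *\<^sub>R \<phi> j))\<^sup>2 = (\<Sum>j\<in>J. (norm (c j *\<^sub>R \<phi> j))\<^sup>2)"
    using assms
    by (intro norm_sum_Pythagorean) (auto simp: pairwise_def orthogonal_def orthonormal_family_def)
  then show ?thesis
    using norm_orthonormal_family[OF assms(2)] by (simp add: power_mult_distrib)
qed

lemma has_sum_norm_sum_orthonormal_family:
  fixes \<phi> :: "'i \<Rightarrow> 'a ell2" and v :: "'i \<Rightarrow> 'v::real_inner"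
  assumes "finite J" "orthonormal_family J \<phi>"
  shows "((\<lambda>x. (norm (\<Sum>j\<in>J. \<phi> j x *\<^sub>R v j))\<^sup>2) has_sum (\<Sum>j\<in>J. (norm (v j))\<^sup>2)) UNIV"
proof -
  have "(norm (\<Sum>j\<in>J. \<phi> j x *\<^sub>R v j))\<^sup>2 = (\<Sum>j\<in>J. \<Sum>i\<in>J. \<phi> i x * \<phi> j x * (v i \<bullet> v j))" for x
    by (simp add: power2_norm_eq_inner inner_sum_left inner_sum_right mult.assoc inner_commute)
  moreover have "((\<lambda>x. \<Sum>j\<in>J. \<Sum>i\<in>J. \<phi> i x * \<phi> j x * (v i \<bullet> v j))
      has_sum (\<Sum>j\<in>J. \<Sum>i\<in>J. (\<phi> i \<bullet> \<phi> j) * (v i \<bullet> v j))) UNIV"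
    by (intro has_sum_sum has_sum_cmult_left has_sum_inner_ell2)
  moreover have "(\<Sum>j\<in>J. \<Sum>i\<in>J. (\<phi> i \<bullet> \<phi> j) * (v i \<bullet> v j)) = (\<Sum>j\<in>J. (norm (v j))\<^sup>2)"
    using assms by (simp add: orthonormal_family_def power2_norm_eq_inner)
  ultimately show ?thesis
    by simp
qed

definition particle_density :: "'i set \<Rightarrow> ('i \<Rightarrow> 'a ell2) \<Rightarrow> 'a \<Rightarrow> real"
  where "particle_density J \<phi> x = (\<Sum>j\<in>J. (\<phi> j x)\<^sup>2)"

lemma particle_density_nonneg: "particle_density J \<phi> x \<ge> 0"
  by (simp add: particle_density_def sum_nonneg)

lemma particle_density_cube_le:
  assumes "finite J" "orthonormal_family J \<phi>"
  shows "particle_density J \<phi> n ^ 3 \<le> (norm (\<Sum>j\<in>J. \<phi> j n *\<^sub>R fwd_diff (\<phi> j)))\<^sup>2"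
proof (cases "particle_density J \<phi> n = 0")
  case False
  define f where "f = (\<Sum>j\<in>J. \<phi> j n *\<^sub>R \<phi> j)"
  have apply_f: "f n = particle_density J \<phi> n"
    by (simp add: f_def particle_density_def power2_eq_square)
  have norm_f: "(norm f)\<^sup>2 = particle_density J \<phi> n"
    using norm_sum_orthonormal_family[OF assms] by (simp add: f_def particle_density_def)
  have fwd_diff_f: "fwd_diff f = (\<Sum>j\<in>J. \<phi> j n *\<^sub>R fwd_diff (\<phi> j))"
    by (simp add: f_def linear_sum[OF linear_fwd_diff] linear_cmul[OF linear_fwd_diff])
  have "((f n)\<^sup>2)\<^sup>2 \<le> (norm f)\<^sup>2 * (norm (fwd_diff f))\<^sup>2"
    unfolding power_mult_distrib[symmetric]
    by (intro power_mono ell2_square_le_norm_mult_norm_fwd_diff) simp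
  then have "particle_density J \<phi> n * particle_density J \<phi> n ^ 3
      \<le> particle_density J \<phi> n * (norm (fwd_diff f))\<^sup>2"
    by (simp add: apply_f norm_f flip: power_mult power_Suc)
  then show ?thesis
    using False particle_density_nonneg[of J \<phi> n] by (simp add: fwd_diff_f)
qed simp

lemma kinetic_energy_inequality:
  assumes "finite J" "orthonormal_family J \<phi>"
  shows "(\<lambda>n. particle_density J \<phi> n ^ 3) summable_on UNIV"
    and "(\<Sum>\<^sub>\<infinity>n. particle_density J \<phi> n ^ 3) \<le> (\<Sum>j\<in>J. (norm (fwd_diff (\<phi> j)))\<^sup>2)"
proof -
  note parseval = has_sum_norm_sum_orthonormal_family[OF assms, of "\<lambda>j. fwd_diff (\<phi> j)"]
  show summable: "(\<lambda>n. particle_density J \<phi> n ^ 3) summable_on UNIV"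
    by (rule summable_on_comparison_test[OF has_sum_imp_summable[OF parseval]])
       (simp_all add: particle_density_cube_le assms particle_density_nonneg)
  show "(\<Sum>\<^sub>\<infinity>n. particle_density J \<phi> n ^ 3) \<le> (\<Sum>j\<in>J. (norm (fwd_diff (\<phi> j)))\<^sup>2)"
    by (rule has_sum_mono[OF has_sum_infsum[OF summable] parseval])
       (rule particle_density_cube_le[OF assms])
qed

section \<open>Eigenvectors\<close>

lemma eigvecE:
  assumes "eigvec b e \<phi>"
  obtains f :: "int ell2" where "\<phi> = f"
  using assms apply_ell2_cases[of \<phi>] by (auto simp: eigvec_def l2_seq_def)

lemma eigvec_ell2_iff:
  fixes f :: "int ell2"
  shows "eigvec b e f \<longleftrightarrow> (\<forall>n. adj_diff (fwd_diff f) n = e * f n + b n * f n)"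
  using apply_ell2[of f]
  by (auto simp: eigvec_def l2_seq_def H_D_def fun_eq_iff apply_fwd_diff apply_adj_diff
      algebra_simps)

lemma eigvec_scaleR:
  fixes f :: "int ell2"
  assumes "eigvec b e f"
  shows "eigvec b e (c *\<^sub>R f)"
proof -
  have "adj_diff (fwd_diff (c *\<^sub>R f)) = c *\<^sub>R adj_diff (fwd_diff f)"
    by (simp add: linear_cmul[OF linear_fwd_diff] linear_cmul[OF linear_adj_diff])
  then show ?thesis
    using assms by (simp add: eigvec_ell2_iff algebra_simps)
qed

text \<open>Boundedness of \<open>b\<close> is not needed, as the eigenvalue equation makes \<open>b \<cdot> f\<close> square-summable.\<close>

lemma has_sum_potential_eigvec:
  fixes f g :: "int ell2"
  assumes "eigvec b e f"
  shows "((\<lambda>n. b n * (f n * g n)) has_sum (fwd_diff f \<bullet> fwd_diff g - e * (f \<bullet> g))) UNIV"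
proof -
  have "((\<lambda>n. g n * (adj_diff (fwd_diff f) - e *\<^sub>R f) n)
      has_sum (g \<bullet> (adj_diff (fwd_diff f) - e *\<^sub>R f))) UNIV"
    by (rule has_sum_inner_ell2)
  also have "(\<lambda>n. g n * (adj_diff (fwd_diff f) - e *\<^sub>R f) n) = (\<lambda>n. b n * (f n * g n))"
    using assms by (simp add: eigvec_ell2_iff mult_ac)
  also have "g \<bullet> (adj_diff (fwd_diff f) - e *\<^sub>R f) = fwd_diff f \<bullet> fwd_diff g - e * (f \<bullet> g)"
    by (simp add: inner_diff_right inner_commute flip: inner_fwd_diff_left)
  finally show ?thesis .
qed

lemma inner_eigvec_eq_0:
  fixes f g :: "int ell2"
  assumes "eigvec b e f" "eigvec b e' g" "e \<noteq> e'"
  shows "f \<bullet> g = 0"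
proof -
  have "((\<lambda>n. b n * (f n * g n)) has_sum (fwd_diff f \<bullet> fwd_diff g - e' * (f \<bullet> g))) UNIV"
    using has_sum_potential_eigvec[OF assms(2), of f] by (simp add: mult.commute inner_commute)
  from has_sum_unique[OF has_sum_potential_eigvec[OF assms(1), of g] this]
  have "e * (f \<bullet> g) = e' * (f \<bullet> g)"
    by simp
  then show ?thesis
    using assms(3) by simp
qed

lemma orthonormal_eigvecsE:
  assumes "\<And>e. e \<in> E \<Longrightarrow> is_eigenvalue b e"
  obtains \<phi> where "orthonormal_family E \<phi>" "\<And>e. e \<in> E \<Longrightarrow> eigvec b e (apply_ell2 (\<phi> e))"
proof -
  have "\<exists>f. eigvec b e (apply_ell2 f) \<and> norm f = 1" if "e \<in> E" for e
  proof -
    obtain \<psi> where \<psi>_eigvec: "eigvec b e \<psi>" "\<psi> \<noteq> (\<lambda>_. 0)"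
      using assms[OF \<open>e \<in> E\<close>] unfolding is_eigenvalue_def by blast
    obtain f :: "int ell2" where \<psi>_eq: "\<psi> = f"
      using eigvecE[OF \<psi>_eigvec(1)] .
    have "eigvec b e (sgn f)"
      using \<psi>_eigvec(1) unfolding \<psi>_eq sgn_div_norm by (rule eigvec_scaleR)
    moreover have "norm (sgn f) = 1"
      using \<psi>_eigvec(2) \<psi>_eq by (auto simp: norm_sgn)
    ultimately show ?thesis
      by blast
  qed
  then obtain \<phi> where eigvec: "\<And>e. e \<in> E \<Longrightarrow> eigvec b e (apply_ell2 (\<phi> e))"
    and norm: "\<And>e. e \<in> E \<Longrightarrow> norm (\<phi> e) = 1"
    by metis
  have "orthonormal_family E \<phi>"
    using norm inner_eigvec_eq_0[OF eigvec eigvec]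
    by (auto simp: orthonormal_family_def dot_square_norm)
  then show ?thesis
    using that eigvec by blast
qed

section \<open>Simplicity of the eigenvalues\<close>

definition three_term_solution :: "(int \<Rightarrow> 'a::comm_ring_1) \<Rightarrow> (int \<Rightarrow> 'a) \<Rightarrow> bool"
  where "three_term_solution a u \<longleftrightarrow> (\<forall>n. u (n + 1) + u (n - 1) = a n * u n)"

lemma three_term_solution_diff_cmult:
  assumes "three_term_solution a u" "three_term_solution a v"
  shows "three_term_solution a (\<lambda>n. u n - c * v n)"
proof -
  have "u (n + 1) - c * v (n + 1) + (u (n - 1) - c * v (n - 1)) = a n * (u n - c * v n)" for n
  proof -
    have "u (n + 1) - c * v (n + 1) + (u (n - 1) - c * v (n - 1))
        = (u (n + 1) + u (n - 1)) - c * (v (n + 1) + v (n - 1))"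
      by (simp add: algebra_simps)
    also have "\<dots> = a n * u n - c * (a n * v n)"
      using assms unfolding three_term_solution_def by simp
    finally show ?thesis
      by (simp add: algebra_simps)
  qed
  then show ?thesis
    by (simp add: three_term_solution_def)
qed

lemma three_term_solution_eq_0:
  assumes "three_term_solution a u" "u k = 0" "u (k + 1) = 0"
  shows "u n = 0"
proof -
  have recurrence: "u (n + 1) + u (n - 1) = a n * u n" for n
    using assms(1) by (simp add: three_term_solution_def)
  have "u n = 0 \<and> u (n + 1) = 0"
  proof (induction n rule: int_induct[where k = k])
    case base
    show ?case using assms by simp
  next
    case (step1 i)
    then show ?case using recurrence[of "i + 1"] by simp
  next
    case (step2 i)
    then show ?case using recurrence[of i] by simp
  qed
  then show ?thesis ..
qed

definition wronskian :: "(int \<Rightarrow> 'a::comm_ring_1) \<Rightarrow> (int \<Rightarrow> 'a) \<Rightarrow> int \<Rightarrow> 'a"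
  where "wronskian u v n = u (n + 1) * v n - u n * v (n + 1)"

lemma wronskian_add_1:
  assumes "three_term_solution a u" "three_term_solution a v"
  shows "wronskian u v (n + 1) = wronskian u v n"
proof -
  have recurrence: "u (n + 1) + u (n - 1) = a n * u n" "v (n + 1) + v (n - 1) = a n * v n" for n
    using assms by (simp_all add: three_term_solution_def)
  have "wronskian u v (n + 1) - wronskian u v n
      = (u (n + 1 + 1) + u (n + 1 - 1)) * v (n + 1) - u (n + 1) * (v (n + 1 + 1) + v (n + 1 - 1))"
    by (simp add: wronskian_def algebra_simps)
  also have "\<dots> = a (n + 1) * u (n + 1) * v (n + 1) - u (n + 1) * (a (n + 1) * v (n + 1))"
    unfolding recurrence ..
  finally show ?thesis
    by (simp add: mult_ac)
qed

lemma wronskian_ell2_eq_0: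
  fixes f g :: "int ell2"
  assumes "three_term_solution a f" "three_term_solution a g"
  shows "wronskian f g n = 0"
proof -
  have wronskian_const: "wronskian f g (n + int k) = wronskian f g n" for k
  proof (induction k)
    case (Suc k)
    then show ?case using wronskian_add_1[OF assms, of "n + int k"] by (simp add: add_ac)
  qed simp
  have "(\<lambda>k. wronskian f g (n + int k)) \<longlonglongrightarrow> 0 * 0 - 0 * 0"
    unfolding wronskian_def by (intro tendsto_intros ell2_tendsto_0) (simp_all add: inj_def)
  then show ?thesis
    by (simp add: wronskian_const LIMSEQ_const_iff)
qed

lemma eigvec_three_term_solution:
  assumes "eigvec b e \<phi>"
  shows "three_term_solution (\<lambda>n. 2 - b n - e) \<phi>"
proof -
  have "H_D b \<phi> n = e * \<phi> n" for n
    using assms by (simp add: eigvec_def)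
  then show ?thesis
    by (simp add: three_term_solution_def H_D_def Dadj_def Dfw_def algebra_simps)
qed

lemma eigvec_proportional:
  assumes "eigvec b e \<phi>" "eigvec b e \<psi>" "\<phi> \<noteq> (\<lambda>_. 0)"
  obtains c where "\<psi> = (\<lambda>n. c * \<phi> n)"
proof -
  note solution = assms(1,2)[THEN eigvec_three_term_solution]
  obtain k where nonzero: "\<phi> k \<noteq> 0"
    using assms(3) by blast
  define c where "c = \<psi> k / \<phi> k"
  obtain f g :: "int ell2" where "\<phi> = f" "\<psi> = g"
    using assms(1,2) by (elim eigvecE)
  then have "wronskian \<phi> \<psi> k = 0"
    using wronskian_ell2_eq_0[of _ f g] solution by simp
  then have "\<psi> k - c * \<phi> k = 0" "\<psi> (k + 1) - c * \<phi> (k + 1) = 0"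
    using nonzero by (simp_all add: c_def wronskian_def field_simps)
  then have "\<psi> n - c * \<phi> n = 0" for n
    by (rule three_term_solution_eq_0[OF three_term_solution_diff_cmult[OF solution(2,1)]])
  then have "\<psi> = (\<lambda>n. c * \<phi> n)"
    by (intro ext) simp
  then show ?thesis
    by (rule that)
qed

lemma lin_indep_fun_pair:
  assumes "lin_indep_fun S" "finite S" "\<phi> \<in> S" "\<psi> \<in> S" "\<phi> \<noteq> \<psi>"
    and "\<And>n. x * \<phi> n + y * \<psi> n = 0"
  shows "x = 0" "y = 0"
proof -
  define c where "c = (\<lambda>_. 0)(\<phi> := x, \<psi> := y)"
  have "(\<Sum>u\<in>S. c u * u n) = (\<Sum>u\<in>{\<phi>, \<psi>}. c u * u n)" for n
    using assms(2-5) by (intro sum.mono_neutral_right) (auto simp: c_def)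
  then have "(\<Sum>u\<in>S. c u * u n) = 0" for n
    using assms(5,6) by (simp add: c_def)
  then have "c \<phi> = 0" "c \<psi> = 0"
    using assms(1,3,4) unfolding lin_indep_fun_def by blast+
  then show "x = 0" "y = 0"
    using assms(5) by (simp_all add: c_def)
qed

lemma eig_mult_le_1: "eig_mult b e \<le> 1"
proof -
  have "card S \<le> 1"
    if "finite S" and eigvec: "\<forall>\<phi>\<in>S. eigvec b e \<phi>" and independent: "lin_indep_fun S" for S
  proof (rule ccontr)
    assume "\<not> card S \<le> 1"
    then obtain \<phi> \<psi> where pair: "\<phi> \<in> S" "\<psi> \<in> S" "\<phi> \<noteq> \<psi>"
      using card_le_Suc0_iff_eq[OF \<open>finite S\<close>] by auto
    note coefficients_eq_0 = lin_indep_fun_pair[OF independent \<open>finite S\<close> pair]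
    have "\<phi> \<noteq> (\<lambda>_. 0)"
      using coefficients_eq_0(1)[of 1 0] by auto
    then obtain c where "\<psi> = (\<lambda>n. c * \<phi> n)"
      using eigvec pair(1,2) eigvec_proportional by metis
    then show False
      using coefficients_eq_0(2)[of "- c" 1] by simp
  qed
  then show ?thesis
    unfolding eig_mult_def by (intro SUP_least) auto
qed

section \<open>Riesz means and the Aizenman--Lieb argument\<close>

definition riesz_mean :: "'a measure \<Rightarrow> ('a \<Rightarrow> real) \<Rightarrow> real \<Rightarrow> real \<Rightarrow> ennreal"
  where "riesz_mean M f p t = (\<integral>\<^sup>+x. ennreal (max 0 (f x - t) powr p) \<partial>M)"

lemma borel_measurable_riesz_mean:
  assumes "sigma_finite_measure M" and [measurable]: "f \<in> borel_measurable M"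
  shows "riesz_mean M f p \<in> borel_measurable borel"
  unfolding riesz_mean_def[abs_def]
  by (rule sigma_finite_measure.borel_measurable_nn_integral[OF assms(1)]) measurable

lemma has_integral_Beta_rescaled:
  fixes a c x :: real
  assumes "a > 0" "c > 0" "x > 0"
  shows "((\<lambda>t. t powr (a - 1) * (x - t) powr (c - 1))
    has_integral (Beta a c * x powr (a + c - 1))) {0..x}"
proof -
  have "((\<lambda>t. (t / x) powr (a - 1) * (1 - t / x) powr (c - 1)) has_integral (x * Beta a c)) {0..x}"
    using has_integral_affinity'[of _ _ 0 "1 :: real" "1 / x" 0] has_integral_Beta_real[of a c]
      assms
    by fastforce
  then have "((\<lambda>t. x powr (a + c - 2) * ((t / x) powr (a - 1) * (1 - t / x) powr (c - 1)))
      has_integral (x powr (a + c - 2) * (x * Beta a c))) {0..x}"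
    by (rule has_integral_mult_right)
  moreover have "x powr (a + c - 2) * ((t / x) powr (a - 1) * (1 - t / x) powr (c - 1))
      = t powr (a - 1) * (x - t) powr (c - 1)" if "t \<in> {0..x}" for t
  proof -
    have "1 - t / x = (x - t) / x"
      using assms(3) by (simp add: field_simps)
    moreover have "x powr (a + c - 2) = x powr (a - 1) * x powr (c - 1)"
      by (simp flip: powr_add)
    ultimately show ?thesis
      using that assms(3) by (simp add: powr_divide)
  qed
  moreover have "x powr (a + c - 2) * (x * Beta a c) = Beta a c * x powr (a + c - 1)"
    using assms(3) powr_add[of x "a + c - 2" 1] by simp
  ultimately show ?thesis
    by (metis (no_types, lifting) has_integral_cong)
qed

lemma nn_integral_Beta_rescaled:
  fixes a c x :: real
  assumes "a > 0" "c > 0"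
  shows "(\<integral>\<^sup>+t\<in>{0<..}. ennreal (t powr (a - 1) * max 0 (x - t) powr (c - 1)) \<partial>lborel)
     = ennreal (Beta a c * max 0 x powr (a + c - 1))"
proof (cases "x > 0")
  case True
  have "(\<integral>\<^sup>+t\<in>{0<..}. ennreal (t powr (a - 1) * max 0 (x - t) powr (c - 1)) \<partial>lborel)
      = (\<integral>\<^sup>+t\<in>{0..x}. ennreal (t powr (a - 1) * (x - t) powr (c - 1)) \<partial>lborel)"
    by (intro nn_integral_cong) (auto simp: indicator_def)
  also have "\<dots> = ennreal (Beta a c * x powr (a + c - 1))"
    using assms True by (intro nn_integral_has_integral_lebesgue' has_integral_Beta_rescaled) auto
  finally show ?thesis
    using True by simp
next
  case False
  then have "(\<integral>\<^sup>+t\<in>{0<..}. ennreal (t powr (a - 1) * max 0 (x - t) powr (c - 1)) \<partial>lborel)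
      = (\<integral>\<^sup>+(t::real). 0 \<partial>lborel)"
    by (intro nn_integral_cong) (auto simp: indicator_def)
  then show ?thesis
    using False by simp
qed

lemma nn_integral_riesz_mean:
  assumes "sigma_finite_measure M" and [measurable]: "f \<in> borel_measurable M"
    and "s > 0" "p > -1"
  shows "(\<integral>\<^sup>+t\<in>{0<..}. ennreal (t powr (s - 1)) * riesz_mean M f p t \<partial>lborel)
    = ennreal (Beta s (p + 1)) * riesz_mean M f (p + s) 0"
proof -
  interpret pair_sigma_finite M lborel
    by (intro pair_sigma_finite.intro assms(1) lborel.sigma_finite_measure_axioms)
  have "(\<integral>\<^sup>+t\<in>{0<..}. ennreal (t powr (s - 1)) * riesz_mean M f p t \<partial>lborel)
      = (\<integral>\<^sup>+t. (\<integral>\<^sup>+x. ennreal (t powr (s - 1) * max 0 (f x - t) powr p)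
          * indicator {0<..} t \<partial>M) \<partial>lborel)"
    unfolding riesz_mean_def
    by (simp add: ennreal_mult' nn_integral_cmult nn_integral_multc)
  also have "\<dots>
      = (\<integral>\<^sup>+x. (\<integral>\<^sup>+t\<in>{0<..}. ennreal (t powr (s - 1) * max 0 (f x - t) powr p) \<partial>lborel) \<partial>M)"
    by (rule Fubini') measurable
  also have "\<dots> = (\<integral>\<^sup>+x. ennreal (Beta s (p + 1)) * ennreal (max 0 (f x - 0) powr (p + s)) \<partial>M)"
    using nn_integral_Beta_rescaled[of s "p + 1"] assms(3,4)
    by (simp add: ennreal_mult'' add.commute)
  also have "\<dots> = ennreal (Beta s (p + 1)) * riesz_mean M f (p + s) 0"
    unfolding riesz_mean_def by (rule nn_integral_cmult) measurable
  finally show ?thesis .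
qed

lemma Aizenman_Lieb:
  assumes "sigma_finite_measure M" "f \<in> borel_measurable M"
    and "sigma_finite_measure N" "g \<in> borel_measurable N"
    and exponents: "s > 0" "p > -1" "q > -1"
    and riesz_mean_le: "\<And>t. t > 0 \<Longrightarrow> riesz_mean M f p t \<le> C * riesz_mean N g q t"
  shows "ennreal (Beta s (p + 1)) * riesz_mean M f (p + s) 0
    \<le> C * (ennreal (Beta s (q + 1)) * riesz_mean N g (q + s) 0)"
proof -
  note [measurable] = borel_measurable_riesz_mean[OF assms(1,2)]
    borel_measurable_riesz_mean[OF assms(3,4)]
  have "ennreal (Beta s (p + 1)) * riesz_mean M f (p + s) 0
      = (\<integral>\<^sup>+t\<in>{0<..}. ennreal (t powr (s - 1)) * riesz_mean M f p t \<partial>lborel)"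
    using assms(1,2) exponents by (simp add: nn_integral_riesz_mean)
  also have "\<dots> \<le> (\<integral>\<^sup>+t\<in>{0<..}. ennreal (t powr (s - 1)) * (C * riesz_mean N g q t) \<partial>lborel)"
    by (intro nn_integral_mono) (auto simp: indicator_def intro!: mult_left_mono riesz_mean_le)
  also have "\<dots> = C * (\<integral>\<^sup>+t\<in>{0<..}. ennreal (t powr (s - 1)) * riesz_mean N g q t \<partial>lborel)"
    by (subst nn_integral_cmult[symmetric]) (simp_all add: mult_ac)
  finally show ?thesis
    using assms(3,4) exponents by (simp add: nn_integral_riesz_mean)
qed

section \<open>The moment inequality\<close>

lemma cubic_Young:
  fixes r x :: real
  assumes "r \<ge> 0"
  shows "x * r \<le> r ^ 3 + 2 / (3 * sqrt 3) * max 0 x powr (3/2)"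
proof -
  have "x * r \<le> max 0 x * r"
    using assms by (intro mult_right_mono) auto
  also have "\<dots> = max 0 x / 3 powr (1/3) * (3 powr (1/3) * r)"
    by simp
  also have "\<dots> \<le> (max 0 x / 3 powr (1/3)) powr (3/2) / (3/2) + (3 powr (1/3) * r) powr 3 / 3"
    using assms by (intro Youngs_inequality) auto
  also have "\<dots> = r ^ 3 + 2 / (3 * sqrt 3) * max 0 x powr (3/2)"
    using assms by (simp add: powr_divide powr_mult powr_powr powr_half_sqrt powr_numeral)
  finally show ?thesis .
qed

definition lieb_thirring_const :: "real \<Rightarrow> real"
  where "lieb_thirring_const \<gamma> = pi / sqrt 3 * L_cl \<gamma>"

lemma lieb_thirring_const_1: "lieb_thirring_const 1 = 2 / (3 * sqrt 3)"
proof -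
  have Gamma_add_1: "Gamma (x + 1) = x * Gamma x" if "x > 0" for x :: real
    using that nonpos_Ints_nonpos[of x] by (intro Gamma_plus1) auto
  have Gamma_five_halves: "Gamma (5/2 :: real) = 3/4 * sqrt pi"
    using Gamma_add_1[of "3/2"] Gamma_add_1[of "1/2"] by (simp add: Gamma_one_half_real)
  show ?thesis
    by (simp add: lieb_thirring_const_def L_cl_def Gamma_numeral Gamma_five_halves field_simps)
qed

lemma lieb_thirring_const_mult_Beta:
  assumes "\<sigma> > -1" "\<gamma> > \<sigma>"
  shows "lieb_thirring_const \<gamma> * Beta (\<gamma> - \<sigma>) (\<sigma> + 1)
    = lieb_thirring_const \<sigma> * Beta (\<gamma> - \<sigma>) (\<sigma> + 3/2)"
proof -
  have "Gamma (\<gamma> + 1) > 0" "Gamma (\<sigma> + 3/2) > 0"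
    using assms by (intro Gamma_real_pos; simp)+
  moreover have "\<gamma> - \<sigma> + (\<sigma> + 1) = \<gamma> + 1" "\<gamma> - \<sigma> + (\<sigma> + 3/2) = \<gamma> + 3/2"
    by simp_all
  ultimately show ?thesis
    unfolding lieb_thirring_const_def L_cl_def Beta_def by (simp add: field_simps)
qed

lemma has_sum_potential_energy:
  fixes \<phi> :: "'i \<Rightarrow> int ell2"
  assumes "orthonormal_family J \<phi>" "\<And>j. j \<in> J \<Longrightarrow> eigvec b (e j) (\<phi> j)"
  shows "((\<lambda>n. (b n - t) * particle_density J \<phi> n)
    has_sum ((\<Sum>j\<in>J. (norm (fwd_diff (\<phi> j)))\<^sup>2) + (\<Sum>j\<in>J. - e j - t))) UNIV"
proof -
  have "((\<lambda>n. (b n - t) * (\<phi> j n)\<^sup>2) has_sum ((norm (fwd_diff (\<phi> j)))\<^sup>2 + (- e j - t))) UNIV"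
    if "j \<in> J" for j
    using has_sum_add[OF has_sum_potential_eigvec[OF assms(2)[OF that], of "\<phi> j"]
        has_sum_cmult_right[OF has_sum_inner_ell2[of "\<phi> j" "\<phi> j"], of "- t"]]
      norm_orthonormal_family[OF assms(1) that]
    by (simp add: dot_square_norm power2_eq_square left_diff_distrib add_diff_eq)
  then have "((\<lambda>n. \<Sum>j\<in>J. (b n - t) * (\<phi> j n)\<^sup>2)
      has_sum (\<Sum>j\<in>J. (norm (fwd_diff (\<phi> j)))\<^sup>2 + (- e j - t))) UNIV"
    by (rule has_sum_sum)
  then show ?thesis
    by (simp only: particle_density_def sum_distrib_left sum.distrib)
qed

lemma sum_eigenvalue_excess_le:
  fixes \<phi> :: "'i \<Rightarrow> int ell2"
  assumes "finite J" "orthonormal_family J \<phi>" "\<And>j. j \<in> J \<Longrightarrow> eigvec b (e j) (\<phi> j)"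
    and "(\<lambda>n. max 0 (b n - t) powr (3/2)) summable_on UNIV"
  shows "(\<Sum>j\<in>J. - e j - t) \<le> lieb_thirring_const 1 * (\<Sum>\<^sub>\<infinity>n. max 0 (b n - t) powr (3/2))"
proof -
  define kinetic where "kinetic = (\<Sum>j\<in>J. (norm (fwd_diff (\<phi> j)))\<^sup>2)"
  define potential where "potential = (\<Sum>\<^sub>\<infinity>n. max 0 (b n - t) powr (3/2))"
  have "((\<lambda>n. (b n - t) * particle_density J \<phi> n) has_sum (kinetic + (\<Sum>j\<in>J. - e j - t))) UNIV"
    unfolding kinetic_def by (intro has_sum_potential_energy assms)
  moreover have "((\<lambda>n. particle_density J \<phi> n ^ 3
        + lieb_thirring_const 1 * max 0 (b n - t) powr (3/2))
      has_sum ((\<Sum>\<^sub>\<infinity>n. particle_density J \<phi> n ^ 3) + lieb_thirring_const 1 * potential)) UNIV"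
    unfolding potential_def
    by (intro has_sum_add has_sum_cmult_right has_sum_infsum kinetic_energy_inequality(1) assms)
  moreover have "(b n - t) * particle_density J \<phi> n
      \<le> particle_density J \<phi> n ^ 3 + lieb_thirring_const 1 * max 0 (b n - t) powr (3/2)" for n
    unfolding lieb_thirring_const_1 by (intro cubic_Young particle_density_nonneg)
  ultimately have "kinetic + (\<Sum>j\<in>J. - e j - t)
      \<le> (\<Sum>\<^sub>\<infinity>n. particle_density J \<phi> n ^ 3) + lieb_thirring_const 1 * potential"
    by (rule has_sum_mono)
  also have "(\<Sum>\<^sub>\<infinity>n. particle_density J \<phi> n ^ 3) \<le> kinetic"
    unfolding kinetic_def by (rule kinetic_energy_inequality(2)[OF assms(1,2)])
  finally show ?thesis
    unfolding potential_def by simp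
qed

lemma riesz_mean_1_eigenvalues_le:
  assumes "finite E" "\<And>e. e \<in> E \<Longrightarrow> is_eigenvalue b e"
  shows "riesz_mean (count_space E) uminus 1 t
    \<le> ennreal (lieb_thirring_const 1) * riesz_mean (count_space UNIV) b (3/2) t"
proof (cases "(\<lambda>n. max 0 (b n - t) powr (3/2)) summable_on UNIV")
  case True
  define J where "J = {e \<in> E. t < - e}"
  obtain \<phi> where eigvecs: "orthonormal_family J \<phi>" "\<And>e. e \<in> J \<Longrightarrow> eigvec b e (apply_ell2 (\<phi> e))"
    using orthonormal_eigvecsE[of J b] assms(2) unfolding J_def by blast
  have "riesz_mean (count_space E) uminus 1 t = (\<Sum>e\<in>E. ennreal (max 0 (- e - t)))"
    using assms(1) by (simp add: riesz_mean_def nn_integral_count_space_finite)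
  also have "\<dots> = (\<Sum>e\<in>J. ennreal (- e - t))"
    using assms(1) unfolding J_def by (intro sum.mono_neutral_cong_right) auto
  also have "\<dots> = ennreal (\<Sum>e\<in>J. - e - t)"
    unfolding J_def by (intro sum_ennreal) auto
  also have "\<dots> \<le> ennreal (lieb_thirring_const 1 * (\<Sum>\<^sub>\<infinity>n. max 0 (b n - t) powr (3/2)))"
    using assms(1) eigvecs True unfolding J_def by (intro ennreal_leI sum_eigenvalue_excess_le) auto
  also have "\<dots> = ennreal (lieb_thirring_const 1) * riesz_mean (count_space UNIV) b (3/2) t"
    using True
    by (simp add: riesz_mean_def nn_integral_count_space_eq_infsum infsum_nonneg ennreal_mult'')
  finally show ?thesis .
next
  case False
  then have "riesz_mean (count_space UNIV) b (3/2) t = \<infinity>"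
    by (simp add: riesz_mean_def nn_integral_count_space_eq_infsum)
  then show ?thesis
    by (simp add: ennreal_mult_top lieb_thirring_const_1)
qed

lemma riesz_mean_eigenvalues_le:
  assumes "\<gamma> \<ge> 1" "finite E" "\<And>e. e \<in> E \<Longrightarrow> is_eigenvalue b e"
  shows "riesz_mean (count_space E) uminus \<gamma> 0
    \<le> ennreal (lieb_thirring_const \<gamma>) * riesz_mean (count_space UNIV) b (\<gamma> + 1/2) 0"
proof (cases "\<gamma> = 1")
  case True
  then show ?thesis
    using riesz_mean_1_eigenvalues_le[OF assms(2,3), of 0] by simp
next
  case False
  then have "\<gamma> > 1"
    using assms(1) by simp
  then have Beta_pos: "Beta (\<gamma> - 1) 2 > 0" "Beta (\<gamma> - 1) (5/2) > 0"
    unfolding Beta_def by (intro divide_pos_pos mult_pos_pos Gamma_real_pos; simp)+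
  let ?R = "riesz_mean (count_space UNIV) b (\<gamma> + 1/2) 0"
  have "ennreal (Beta (\<gamma> - 1) (1 + 1)) * riesz_mean (count_space E) uminus (1 + (\<gamma> - 1)) 0
      \<le> ennreal (lieb_thirring_const 1) * (ennreal (Beta (\<gamma> - 1) (3/2 + 1))
          * riesz_mean (count_space UNIV) b (3/2 + (\<gamma> - 1)) 0)"
    using \<open>\<gamma> > 1\<close> assms(2,3)
    by (intro Aizenman_Lieb riesz_mean_1_eigenvalues_le sigma_finite_measure_count_space
        sigma_finite_measure_count_space_finite) auto
  then have "ennreal (Beta (\<gamma> - 1) 2) * riesz_mean (count_space E) uminus \<gamma> 0
      \<le> ennreal (lieb_thirring_const 1) * (ennreal (Beta (\<gamma> - 1) (5/2)) * ?R)"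
    by (simp add: add.commute)
  also have "\<dots> = ennreal (lieb_thirring_const 1 * Beta (\<gamma> - 1) (5/2)) * ?R"
    using Beta_pos by (simp add: ennreal_mult'' mult.assoc)
  also have "lieb_thirring_const 1 * Beta (\<gamma> - 1) (5/2) = lieb_thirring_const \<gamma> * Beta (\<gamma> - 1) 2"
    using lieb_thirring_const_mult_Beta[of 1 \<gamma>] \<open>\<gamma> > 1\<close> by simp
  also have "ennreal (lieb_thirring_const \<gamma> * Beta (\<gamma> - 1) 2) * ?R
      = ennreal (Beta (\<gamma> - 1) 2) * (ennreal (lieb_thirring_const \<gamma>) * ?R)"
    using Beta_pos by (simp add: ennreal_mult'' mult_ac)
  finally show ?thesis
    using Beta_pos(1) by (simp add: ennreal_mult_le_mult_iff)
qed

theorem theorem1p3: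
  fixes \<gamma> :: real and b :: "int \<Rightarrow> real"
  assumes "\<gamma> \<ge> 1"
    and "\<And>n. b n \<ge> 0"
    and "(\<lambda>n. b n powr (\<gamma> + 1/2)) summable_on UNIV"
  shows "(\<Sum>\<^sub>\<infinity>e\<in>{e. e < 0 \<and> is_eigenvalue b e}. eig_mult b e * ennreal (\<bar>e\<bar> powr \<gamma>))
          \<le> ennreal (pi / sqrt 3 * L_cl \<gamma> * (\<Sum>\<^sub>\<infinity>n. b n powr (\<gamma> + 1/2)))"
proof (rule infsum_le_finite_sums)
  fix E assume finite: "finite E" and eigenvalues: "E \<subseteq> {e. e < 0 \<and> is_eigenvalue b e}"
  have "(\<Sum>e\<in>E. eig_mult b e * ennreal (\<bar>e\<bar> powr \<gamma>)) \<le> (\<Sum>e\<in>E. 1 * ennreal (\<bar>e\<bar> powr \<gamma>))"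
    by (intro sum_mono mult_right_mono eig_mult_le_1) simp
  also have "\<dots> = (\<Sum>e\<in>E. ennreal (max 0 (- e - 0) powr \<gamma>))"
    using eigenvalues by (intro sum.cong) auto
  also have "\<dots> = riesz_mean (count_space E) uminus \<gamma> 0"
    using finite by (simp add: riesz_mean_def nn_integral_count_space_finite)
  also have "\<dots> \<le> ennreal (lieb_thirring_const \<gamma>) * riesz_mean (count_space UNIV) b (\<gamma> + 1/2) 0"
    using assms(1) finite eigenvalues by (intro riesz_mean_eigenvalues_le) auto
  also have "\<dots> = ennreal (lieb_thirring_const \<gamma> * (\<Sum>\<^sub>\<infinity>n. b n powr (\<gamma> + 1/2)))"
    using assms(2,3)
    by (simp add: riesz_mean_def max_absorb2 nn_integral_count_space_eq_infsum infsum_nonneg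
        ennreal_mult'')
  finally show "(\<Sum>e\<in>E. eig_mult b e * ennreal (\<bar>e\<bar> powr \<gamma>))
      \<le> ennreal (pi / sqrt 3 * L_cl \<gamma> * (\<Sum>\<^sub>\<infinity>n. b n powr (\<gamma> + 1/2)))"
    unfolding lieb_thirring_const_def .
qed (simp add: nonneg_summable_on_complete)

end
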